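(* Let $k,d\ge 1$ and $n\ge k$ be integers, and let $H=\sum_{1\le i_1<\cdots<i_k\le n} H_{i_1,\ldots,i_k}$ be an instance of the MAX-$k$-local Hamiltonian problem on $n$ qudits of dimension $d$, with optimal value $\mathrm{OPT}=\lambda_{\max}(H)$. Then there exists a pure product state $\lvert\phi\rangle=\lvert\phi_1\rangle\otimes\cdots\otimes\lvert\phi_n\rangle$, with each $\lvert\phi_i\rangle\in\mathbb{C}^d$ a unit vector, such that $\langle\phi\rvert H\lvert\phi\rangle\ge \mathrm{OPT}/d^{k-1}$.
   Context: MAX-$k$-local Hamiltonian on $d$-level systems (qudits): an instance on $n$ qudits (Hilbert space $(\mathbb{C}^d)^{\otimes n}$) consists of one Hermitian matrix $H_{i_1,\ldots,i_k}$ for each $k$-element subset $\{i_1,\ldots,i_k\}$ of the qudits; each $H_{i_1,\ldots,i_k}$ acts nontrivially only on those $k$ qudits (i.e. is a positive semidefinite operator on $(\mathbb{C}^d)^{\otimes k}$ of operator norm at most $1$, tensored with the identity on the other qudits). Put $H=\sum H_{i_1,\ldots,i_k}$. An assignment is any (pure or mixed) state $\rho$ on the $n$ qudits, with value $\mathrm{Tr}(H\rho)$; the optimal value $\mathrm{OPT}$ is the largest eigenvalue of $H$, i.e. the maximal value of an assignment. *)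

theory Defs
  imports Complex_Main "HOL-Library.FuncSet"
begin

text \<open>Qudits are indexed by 0..<n, each with computational basis 0..<d.
  A basis state of a set S of qudits is an extensional function S \<rightarrow> {0..<d};
  an operator on the qudits in S is a complex matrix indexed by such basis states,
  and a vector is a complex function on them.\<close>

definition basis_states :: "nat set \<Rightarrow> nat \<Rightarrow> (nat \<Rightarrow> nat) set" where
  "basis_states S d = (S \<rightarrow>\<^sub>E {0..<d})"

definition qform :: "('a \<Rightarrow> 'a \<Rightarrow> complex) \<Rightarrow> 'a set \<Rightarrow> ('a \<Rightarrow> complex) \<Rightarrow> complex" where
  "qform A B v = (\<Sum>a\<in>B. \<Sum>b\<in>B. cnj (v a) * A a b * v b)"

definition is_hermitian :: "('a \<Rightarrow> 'a \<Rightarrow> complex) \<Rightarrow> 'a set \<Rightarrow> bool" where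
  "is_hermitian A B \<longleftrightarrow> (\<forall>a\<in>B. \<forall>b\<in>B. A a b = cnj (A b a))"

definition is_psd :: "('a \<Rightarrow> 'a \<Rightarrow> complex) \<Rightarrow> 'a set \<Rightarrow> bool" where
  "is_psd A B \<longleftrightarrow> is_hermitian A B \<and> (\<forall>v. Re (qform A B v) \<ge> 0)"

definition opnorm_le_1 :: "('a \<Rightarrow> 'a \<Rightarrow> complex) \<Rightarrow> 'a set \<Rightarrow> bool" where
  "opnorm_le_1 A B \<longleftrightarrow>
     (\<forall>v. (\<Sum>a\<in>B. (cmod (\<Sum>b\<in>B. A a b * v b))\<^sup>2) \<le> (\<Sum>a\<in>B. (cmod (v a))\<^sup>2))"

definition k_subsets :: "nat \<Rightarrow> nat \<Rightarrow> nat set set" where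
  "k_subsets n k = {S. S \<subseteq> {0..<n} \<and> card S = k}"

definition valid_instance ::
  "nat \<Rightarrow> nat \<Rightarrow> nat \<Rightarrow> (nat set \<Rightarrow> (nat \<Rightarrow> nat) \<Rightarrow> (nat \<Rightarrow> nat) \<Rightarrow> complex) \<Rightarrow> bool" where
  "valid_instance n d k h \<longleftrightarrow>
     (\<forall>S\<in>k_subsets n k. is_psd (h S) (basis_states S d) \<and> opnorm_le_1 (h S) (basis_states S d))"

text \<open>The local term h S tensored with the identity on the remaining qudits.\<close>
definition embed_local ::
  "nat \<Rightarrow> nat set \<Rightarrow> ((nat \<Rightarrow> nat) \<Rightarrow> (nat \<Rightarrow> nat) \<Rightarrow> complex) \<Rightarrow> (nat \<Rightarrow> nat) \<Rightarrow> (nat \<Rightarrow> nat) \<Rightarrow> complex" where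
  "embed_local n S A x y =
     (if (\<forall>i\<in>{0..<n} - S. x i = y i) then A (restrict x S) (restrict y S) else 0)"

definition hamiltonian ::
  "nat \<Rightarrow> nat \<Rightarrow> (nat set \<Rightarrow> (nat \<Rightarrow> nat) \<Rightarrow> (nat \<Rightarrow> nat) \<Rightarrow> complex) \<Rightarrow> (nat \<Rightarrow> nat) \<Rightarrow> (nat \<Rightarrow> nat) \<Rightarrow> complex" where
  "hamiltonian n k h x y = (\<Sum>S\<in>k_subsets n k. embed_local n S (h S) x y)"

definition is_eigenvalue :: "('a \<Rightarrow> 'a \<Rightarrow> complex) \<Rightarrow> 'a set \<Rightarrow> complex \<Rightarrow> bool" where
  "is_eigenvalue A B c \<longleftrightarrow>
     (\<exists>v. (\<exists>a\<in>B. v a \<noteq> 0) \<and> (\<forall>a\<in>B. (\<Sum>b\<in>B. A a b * v b) = c * v a))"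

text \<open>OPT: the largest eigenvalue of H (eigenvalues of a Hermitian matrix are real).\<close>
definition OPT :: "nat \<Rightarrow> nat \<Rightarrow> nat \<Rightarrow> (nat set \<Rightarrow> (nat \<Rightarrow> nat) \<Rightarrow> (nat \<Rightarrow> nat) \<Rightarrow> complex) \<Rightarrow> real" where
  "OPT n d k h = Max (Re ` {c. is_eigenvalue (hamiltonian n k h) (basis_states {0..<n} d) c})"

definition product_state :: "nat \<Rightarrow> (nat \<Rightarrow> nat \<Rightarrow> complex) \<Rightarrow> (nat \<Rightarrow> nat) \<Rightarrow> complex" where
  "product_state n \<phi> x = (\<Prod>i<n. \<phi> i (x i))"

definition unit_vec :: "nat \<Rightarrow> (nat \<Rightarrow> complex) \<Rightarrow> bool" where
  "unit_vec d u \<longleftrightarrow> (\<Sum>a<d. (cmod (u a))\<^sup>2) = 1"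

end

theory Submission
  imports Defs "HOL-Analysis.Analysis"
begin

text \<open>
  Start from a top eigenvector of the Hamiltonian and disentangle the qudits one at a time: expand
  the state in its Schmidt decomposition between qudit \<open>m\<close> and the later qudits, and keep one of
  the at most \<open>d\<close> branches. On average over the branches, a local term not acting on qudit \<open>m\<close> keeps
  its value because the Schmidt vectors of qudit \<open>m\<close> are orthogonal; a term acting on qudit \<open>m\<close> but
  on no later qudit keeps its value because the partner vectors are orthogonal; any other term is
  positive semidefinite and hence loses at most a factor \<open>d\<close>. So a term on \<open>k\<close> qudits loses a factor
  \<open>d\<close> at most \<open>k - 1\<close> times, and some branch is at least as good as the average.
\<close>

section \<open>Sesquilinear forms and the spectral theorem\<close>

definition ip :: "'a set \<Rightarrow> ('a \<Rightarrow> complex) \<Rightarrow> ('a \<Rightarrow> complex) \<Rightarrow> complex" where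
  "ip B u v = (\<Sum>a\<in>B. cnj (u a) * v a)"

definition mat_app :: "('a \<Rightarrow> 'a \<Rightarrow> complex) \<Rightarrow> 'a set \<Rightarrow> ('a \<Rightarrow> complex) \<Rightarrow> 'a \<Rightarrow> complex" where
  "mat_app A B v a = (\<Sum>b\<in>B. A a b * v b)"

definition sesq :: "('a \<Rightarrow> 'a \<Rightarrow> complex) \<Rightarrow> 'a set \<Rightarrow> ('a \<Rightarrow> complex) \<Rightarrow> ('a \<Rightarrow> complex) \<Rightarrow> complex" where
  "sesq A B u v = (\<Sum>a\<in>B. \<Sum>b\<in>B. cnj (u a) * A a b * v b)"

lemma qform_eq_sesq: "qform A B v = sesq A B v v"
  by (simp add: qform_def sesq_def)

lemma sesq_eq_ip: "sesq A B u v = ip B u (mat_app A B v)"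
  by (simp add: sesq_def ip_def mat_app_def sum_distrib_left mult.assoc)

lemma ip_cong: "(\<And>a. a \<in> B \<Longrightarrow> u a = u' a) \<Longrightarrow> (\<And>a. a \<in> B \<Longrightarrow> v a = v' a) \<Longrightarrow> ip B u v = ip B u' v'"
  by (simp add: ip_def)

lemma sesq_cong:
  "(\<And>a. a \<in> B \<Longrightarrow> u a = u' a) \<Longrightarrow> (\<And>a. a \<in> B \<Longrightarrow> v a = v' a) \<Longrightarrow> sesq A B u v = sesq A B u' v'"
  by (simp add: sesq_def)

lemma ip_simps:
  "ip B u (\<lambda>a. v a + w a) = ip B u v + ip B u w"
  "ip B u (\<lambda>a. v a - w a) = ip B u v - ip B u w"
  "ip B u (\<lambda>a. c * v a) = c * ip B u v"
  "ip B (\<lambda>a. v a + w a) u = ip B v u + ip B w u"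
  "ip B (\<lambda>a. v a - w a) u = ip B v u - ip B w u"
  "ip B (\<lambda>a. c * v a) u = cnj c * ip B v u"
  by (simp_all add: ip_def sum.distrib sum_subtractf sum_distrib_left algebra_simps)

lemma mat_app_simps:
  "mat_app A B (\<lambda>a. v a + w a) = (\<lambda>a. mat_app A B v a + mat_app A B w a)"
  "mat_app A B (\<lambda>a. c * v a) = (\<lambda>a. c * mat_app A B v a)"
  by (auto simp add: mat_app_def sum.distrib sum_distrib_left algebra_simps)

lemma ip_sum_right: "ip B u (\<lambda>a. \<Sum>j\<in>J. v j a) = (\<Sum>j\<in>J. ip B u (v j))"
  unfolding ip_def sum_distrib_left by (rule sum.swap)

lemma ip_cnj: "cnj (ip B u v) = ip B v u"
  by (simp add: ip_def mult.commute)

lemma ip_self: "ip B v v = complex_of_real (\<Sum>a\<in>B. (cmod (v a))\<^sup>2)"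
  unfolding ip_def of_real_sum
  by (rule sum.cong) (simp_all add: mult.commute[of "cnj _"] flip: complex_norm_square)

lemma Re_ip_self: "Re (ip B v v) = (\<Sum>a\<in>B. (cmod (v a))\<^sup>2)"
  by (simp add: ip_self)

lemma ip_self_eq_Re: "ip B v v = complex_of_real (Re (ip B v v))"
  by (simp add: ip_self)

lemma Re_ip_self_ge_0: "Re (ip B v v) \<ge> 0"
  by (simp add: Re_ip_self sum_nonneg)

lemma ip_self_eq_0: "finite B \<Longrightarrow> Re (ip B v v) = 0 \<Longrightarrow> a \<in> B \<Longrightarrow> v a = 0"
  by (auto simp add: Re_ip_self sum_nonneg_eq_0_iff)

lemma ip_mat_app_hermitian:
  assumes "is_hermitian A B"
  shows "ip B u (mat_app A B v) = ip B (mat_app A B u) v"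
proof -
  have "ip B u (mat_app A B v) = (\<Sum>b\<in>B. \<Sum>a\<in>B. cnj (u a) * A a b * v b)"
    by (simp add: ip_def mat_app_def sum_distrib_left mult.assoc) (rule sum.swap)
  also have "\<dots> = ip B (mat_app A B u) v"
    unfolding ip_def mat_app_def cnj_sum sum_distrib_right
  proof (intro sum.cong refl)
    fix a b assume "a \<in> B" "b \<in> B"
    then have "A a b = cnj (A b a)" using assms unfolding is_hermitian_def by blast
    then show "cnj (u a) * A a b * v b = cnj (A b a * u a) * v b" by simp
  qed
  finally show ?thesis .
qed

text \<open>The eigenvector is a maximiser of the Rayleigh quotient over the complement.\<close>
lemma eigenvector_in_orthogonal_complement:
  fixes A :: "'a \<Rightarrow> 'a \<Rightarrow> complex"
  assumes fin: "finite B" and herm: "is_hermitian A B"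
    and ev: "\<And>j a. j < m \<Longrightarrow> a \<in> B \<Longrightarrow> mat_app A B (e j) a = complex_of_real (l j) * e j a"
    and v0: "a0 \<in> B" "v0 a0 \<noteq> 0" "\<And>j. j < m \<Longrightarrow> ip B (e j) v0 = 0"
  shows "\<exists>w c. ip B w w = 1 \<and> (\<forall>j<m. ip B (e j) w = 0) \<and>
    (\<forall>a\<in>B. mat_app A B w a = complex_of_real c * w a)"
proof -
  define V where "V = {v. \<forall>j<m. ip B (e j) v = 0}"
  \<comment> \<open>The type of indices may be infinite, and \<open>ip B\<close> does not see
    coordinates off \<open>B\<close>. Pinning those to 0 and the others to the closed unit disc
    makes \<open>C\<close> compact by Tychonoff.\<close>
  define C where "C = (\<Pi>\<^sub>E a\<in>UNIV. if a \<in> B then cball 0 1 else {0::complex})"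
  define K where "K = C \<inter> ({v. ip B v v = 1} \<inter> V)"
  define f where "f v = Re (ip B v (mat_app A B v))" for v
  have cont_ip: "continuous_on UNIV (\<lambda>v. ip B (g v) (h v))"
    if "\<And>a. continuous_on UNIV (\<lambda>v. g v a)" "\<And>a. continuous_on UNIV (\<lambda>v. h v a)"
    for g h :: "('a \<Rightarrow> complex) \<Rightarrow> 'a \<Rightarrow> complex"
    unfolding ip_def using that by (intro continuous_intros)
  have cont_app: "continuous_on UNIV (\<lambda>v. v a)" for a :: 'a
    by (rule continuous_on_product_coordinates)
  have cont_mat: "continuous_on UNIV (\<lambda>v. mat_app A B v a)" for a
    unfolding mat_app_def using cont_app by (intro continuous_intros)
  have "compact C"
    unfolding C_def compactin_euclidean_iff[symmetric]
    by (subst euclidean_product_topology[symmetric]) (simp add: compactin_PiE compactin_euclidean_iff compact_cball)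
  moreover have "closed {v. ip B v v = 1}"
    by (intro closed_Collect_eq cont_ip cont_app continuous_intros)
  moreover have "closed V"
    unfolding V_def
    by (intro closed_Collect_all closed_Collect_imp closed_Collect_eq cont_ip cont_app continuous_intros) auto
  ultimately have "compact K"
    unfolding K_def by (intro compact_Int_closed closed_Int)
  \<comment> \<open>Rescaling alone need not land in \<open>C\<close>; the values off
    \<open>B\<close> are reset to 0, which changes no inner product, so proportionality is claimed
    only on \<open>B\<close>.\<close>
  have normalise: "\<exists>u'\<in>K. \<forall>a\<in>B. u a = complex_of_real (sqrt (Re (ip B u u))) * u' a"
    if u: "u \<in> V" "Re (ip B u u) \<noteq> 0" for u
  proof -
    define s where "s = Re (ip B u u)"
    have s: "s > 0" using u Re_ip_self_ge_0[of B u] by (auto simp: s_def)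
    define u' where "u' a = (if a \<in> B then complex_of_real (1 / sqrt s) * u a else 0)" for a
    have eq: "ip B w u' = complex_of_real (1 / sqrt s) * ip B w u" for w
      by (subst ip_simps(3)[symmetric]) (rule ip_cong, auto simp: u'_def)
    have eq': "ip B u' w = complex_of_real (1 / sqrt s) * ip B u w" for w
      using arg_cong[OF eq[of w], of cnj] by (simp add: ip_cnj)
    have "ip B u' u' = complex_of_real (1 / sqrt s) * (complex_of_real (1 / sqrt s) * ip B u u)"
      by (simp only: eq eq')
    also have "\<dots> = complex_of_real (1 / sqrt s * (1 / sqrt s) * s)"
      by (subst ip_self_eq_Re) (simp only: s_def of_real_mult mult.assoc)
    also have "1 / sqrt s * (1 / sqrt s) * s = 1"
      using s by simp
    finally have n1: "ip B u' u' = 1" by simp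
    then have sum1: "(\<Sum>a\<in>B. (cmod (u' a))\<^sup>2) = 1"
      by (metis Re_ip_self one_complex.sel(1))
    have "(cmod (u' a))\<^sup>2 \<le> 1" if "a \<in> B" for a
      using member_le_sum[of a B "\<lambda>a. (cmod (u' a))\<^sup>2"] that fin sum1 by simp
    then have "cmod (u' a) \<le> 1" if "a \<in> B" for a
      using that power2_le_imp_le[of "cmod (u' a)" 1] by simp
    then have "u' \<in> C" by (auto simp: C_def u'_def)
    moreover have "u' \<in> V" using u by (auto simp: V_def eq)
    moreover have "u a = complex_of_real (sqrt s) * u' a" if "a \<in> B" for a
      using that s by (simp add: u'_def)
    ultimately show ?thesis using n1 by (auto simp: K_def s_def)
  qed
  have v0V: "v0 \<in> V" using v0 by (simp add: V_def)
  have "Re (ip B v0 v0) \<noteq> 0" using ip_self_eq_0[OF fin] v0 by blast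
  with v0V normalise have "K \<noteq> {}" by blast
  moreover have "continuous_on K f"
    unfolding f_def
    by (rule continuous_on_subset[of UNIV]) (intro continuous_intros cont_ip cont_app cont_mat, simp)
  ultimately obtain w where w: "w \<in> K" and max: "\<And>u. u \<in> K \<Longrightarrow> f u \<le> f w"
    using continuous_attains_sup[OF \<open>compact K\<close>, of f] by blast
  have wV: "w \<in> V" and w1: "ip B w w = 1" using w by (auto simp: K_def)
  define c where "c = f w"
  \<comment> \<open>Both sides are quadratic in \<open>u\<close>, so the maximum over unit vectors
    extends to all of \<open>V\<close>.\<close>
  have rayleigh: "f u \<le> c * Re (ip B u u)" if u: "u \<in> V" for u
  proof (cases "Re (ip B u u) = 0")
    case True
    then have "u a = 0" if "a \<in> B" for a using ip_self_eq_0[OF fin] that by blast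
    then have "f u = 0" by (simp add: f_def ip_def)
    with True show ?thesis by simp
  next
    case False
    define s where "s = Re (ip B u u)"
    have s: "s \<ge> 0" by (simp add: s_def Re_ip_self_ge_0)
    obtain u' where u': "u' \<in> K" and eq: "\<And>a. a \<in> B \<Longrightarrow> u a = complex_of_real (sqrt s) * u' a"
      using normalise[OF u False] by (auto simp: s_def)
    have "mat_app A B u a = complex_of_real (sqrt s) * mat_app A B u' a" for a
      using eq by (simp add: mat_app_def sum_distrib_left algebra_simps)
    then have "ip B u (mat_app A B u) = ip B (\<lambda>a. complex_of_real (sqrt s) * u' a)
        (\<lambda>a. complex_of_real (sqrt s) * mat_app A B u' a)"
      using eq by (intro ip_cong) auto
    also have "\<dots> = complex_of_real (sqrt s * sqrt s) * ip B u' (mat_app A B u')"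
      by (simp only: ip_simps complex_cnj_complex_of_real of_real_mult mult.assoc)
    finally have "f u = s * f u'" using s by (simp add: f_def)
    then show ?thesis using max[OF u'] s by (simp add: c_def s_def[symmetric] mult.commute mult_left_mono)
  qed
  \<comment> \<open>The residual \<open>r\<close> stays in \<open>V\<close>, because
    \<open>A\<close> is hermitian and the \<open>e j\<close> are eigenvectors. Hence
    \<open>w + t r\<close> competes with \<open>w\<close> for every real \<open>t\<close>.\<close>
  define r where "r a = mat_app A B w a - complex_of_real c * w a" for a
  have rV: "r \<in> V"
  proof -
    have "ip B (e j) r = 0" if j: "j < m" for j
    proof -
      have "ip B (e j) (mat_app A B w) = ip B (mat_app A B (e j)) w"
        by (rule ip_mat_app_hermitian[OF herm])
      also have "\<dots> = ip B (\<lambda>a. complex_of_real (l j) * e j a) w"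
        using ev[OF j] by (intro ip_cong) auto
      also have "\<dots> = 0" using wV j by (simp add: ip_simps V_def)
      finally show ?thesis using wV j by (simp add: r_def[abs_def] ip_simps V_def)
    qed
    then show ?thesis by (simp add: V_def)
  qed
  define s where "s = Re (ip B r r)"
  have s_eq: "Re (ip B r (mat_app A B w)) - c * Re (ip B r w) = s"
  proof -
    have "ip B r r = ip B r (mat_app A B w) - complex_of_real c * ip B r w"
      by (subst (2) r_def[abs_def]) (simp only: ip_simps)
    then show ?thesis by (simp add: s_def)
  qed
  \<comment> \<open>First variation at the maximiser: in the Rayleigh bound for
    \<open>w + t r\<close> the constant terms cancel, and by \<open>s_eq\<close> the linear terms
    combine to \<open>2 * t * s\<close>.\<close>
  have key: "2 * t * s \<le> t\<^sup>2 * (c * s - f r)" for t :: real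
  proof -
    define u where "u a = w a + complex_of_real t * r a" for a
    have uV: "u \<in> V" using wV rV by (simp add: V_def u_def[abs_def] ip_simps)
    have n: "Re (ip B u u) = 1 + 2 * t * Re (ip B r w) + t\<^sup>2 * s"
      using w1 arg_cong[OF ip_cnj[of B r w], of Re]
      by (simp add: u_def[abs_def] ip_simps s_def power2_eq_square algebra_simps)
    have h: "Re (ip B w (mat_app A B r)) = Re (ip B r (mat_app A B w))"
      using ip_mat_app_hermitian[OF herm, of w r] ip_cnj[of B r "mat_app A B w"] by (metis complex_cnj(1) complex.sel(1) cnj.simps(1))
    have q: "f u = c + 2 * t * Re (ip B r (mat_app A B w)) + t\<^sup>2 * f r"
      using h unfolding c_def f_def
      by (simp add: u_def[abs_def] ip_simps mat_app_simps power2_eq_square algebra_simps)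
    have "c + 2 * t * Re (ip B r (mat_app A B w)) + t\<^sup>2 * f r \<le> c * (1 + 2 * t * Re (ip B r w) + t\<^sup>2 * s)"
      using rayleigh[OF uV] unfolding n q .
    then show ?thesis unfolding s_eq[symmetric] by (simp add: algebra_simps)
  qed
  have "s = 0"
  proof (rule ccontr)
    assume "s \<noteq> 0"
    then have s: "s > 0" using Re_ip_self_ge_0[of B r] by (simp add: s_def)
    define D where "D = c * s - f r"
    \<comment> \<open>Small enough that \<open>t * D\<close> is at most \<open>s\<close>, whereas
      \<open>key\<close> demands at least \<open>2 * s\<close>; the summand 1 covers
      \<open>D = 0\<close>.\<close>
    define t where "t = s / (\<bar>D\<bar> + 1)"
    have t: "t > 0" using s by (simp add: t_def)
    have "t * (2 * s) \<le> t * (t * D)" using key[of t] by (simp add: D_def power2_eq_square mult.assoc mult.left_commute)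
    then have "2 * s \<le> t * D" using t by simp
    also have "\<dots> \<le> t * (\<bar>D\<bar> + 1)" using t by (intro mult_left_mono) auto
    also have "\<dots> = s" by (simp add: t_def)
    finally show False using s by simp
  qed
  then have "r a = 0" if "a \<in> B" for a
    using ip_self_eq_0[OF fin] that by (simp add: s_def)
  then have "\<forall>a\<in>B. mat_app A B w a = complex_of_real c * w a" by (simp add: r_def)
  then show ?thesis using w1 wV by (auto simp: V_def)
qed

section \<open>Orthonormal eigenvectors, completeness and the Schmidt decomposition\<close>

definition eigenfamily ::
  "('a \<Rightarrow> 'a \<Rightarrow> complex) \<Rightarrow> 'a set \<Rightarrow> nat \<Rightarrow> (nat \<Rightarrow> 'a \<Rightarrow> complex) \<Rightarrow> (nat \<Rightarrow> real) \<Rightarrow> bool" where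
  "eigenfamily A B m e l \<longleftrightarrow>
     (\<forall>i<m. \<forall>j<m. ip B (e i) (e j) = (if i = j then 1 else 0)) \<and>
     (\<forall>j<m. \<forall>a\<in>B. mat_app A B (e j) a = complex_of_real (l j) * e j a)"

lemma ip_indicator:
  assumes "finite B" "b \<in> B"
  shows "ip B u (\<lambda>x. if x = b then 1 else 0) = cnj (u b)"
  using assms by (simp add: ip_def if_distrib[of "(*) _"] cong: if_cong)

lemma ip_orthonormal_residual:
  fixes m :: nat
  assumes "\<And>i j. i < m \<Longrightarrow> j < m \<Longrightarrow> ip B (e i) (e j) = (if i = j then 1 else 0)" "i < m"
  shows "ip B (e i) (\<lambda>a. v a - (\<Sum>j<m. ip B (e j) v * e j a)) = 0"
proof -
  have "ip B (e i) (\<lambda>a. \<Sum>j<m. ip B (e j) v * e j a) = (\<Sum>j<m. ip B (e j) v * (if i = j then 1 else 0))"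
    using assms by (simp add: ip_sum_right ip_simps)
  also have "\<dots> = ip B (e i) v"
    using \<open>i < m\<close> by (simp add: if_distrib[of "(*) _"] sum.delta' cong: if_cong)
  finally show ?thesis by (simp add: ip_simps)
qed

text \<open>Double counting: Bessel's inequality for the indicator of \<open>b\<close> bounds the
  squared entries of all \<open>e j\<close> at \<open>b\<close> by 1 in total, while summing over
  \<open>b\<close> first gives 1 for each \<open>j\<close>. The bound guarantees that a maximal
  eigenfamily exists.\<close>

lemma card_orthonormal_le:
  fixes m :: nat
  assumes fin: "finite B"
    and on: "\<And>i j. i < m \<Longrightarrow> j < m \<Longrightarrow> ip B (e i) (e j) = (if i = j then 1 else 0)"
  shows "m \<le> card B"
proof -
  have bessel: "(\<Sum>j<m. (cmod (e j b))\<^sup>2) \<le> 1" if b: "b \<in> B" for b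
  proof -
    define v :: "'a \<Rightarrow> complex" where "v = (\<lambda>x. if x = b then 1 else 0)"
    define p where "p = (\<lambda>a. \<Sum>j<m. ip B (e j) v * e j a)"
    define r where "r a = v a - p a" for a
    have orth: "ip B (e j) r = 0" if "j < m" for j
      unfolding r_def p_def using ip_orthonormal_residual[OF on that] .
    have ev: "ip B (e j) v = cnj (e j b)" for j unfolding v_def using fin b by (rule ip_indicator)
    \<comment> \<open>The residual is orthogonal to the projection \<open>p\<close>, so its squared
      norm collapses to its overlap with the indicator, a single entry of \<open>r\<close>.\<close>
    have "ip B r p = (\<Sum>j<m. ip B (e j) v * ip B r (e j))"
      unfolding p_def by (simp add: ip_sum_right ip_simps)
    also have "\<dots> = 0" using orth ip_cnj[of B _ r] by (intro sum.neutral) (metis complex_cnj_zero lessThan_iff mult_zero_right)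
    finally have "ip B r r = ip B r v"
      by (subst (2) r_def[abs_def]) (simp add: ip_simps)
    also have "\<dots> = cnj (r b)" unfolding v_def using fin b by (rule ip_indicator)
    also have "\<dots> = 1 - (\<Sum>j<m. e j b * cnj (e j b))"
      by (simp add: r_def p_def ev v_def[THEN fun_cong] mult.commute)
    also have "\<dots> = complex_of_real (1 - (\<Sum>j<m. (cmod (e j b))\<^sup>2))"
      by (simp flip: complex_norm_square)
    finally have "Re (ip B r r) = 1 - (\<Sum>j<m. (cmod (e j b))\<^sup>2)" by simp
    then show ?thesis using Re_ip_self_ge_0[of B r] by simp
  qed
  have "real m = (\<Sum>j<m. Re (ip B (e j) (e j)))" using on by simp
  also have "\<dots> = (\<Sum>b\<in>B. \<Sum>j<m. (cmod (e j b))\<^sup>2)"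
    unfolding Re_ip_self by (rule sum.swap)
  also have "\<dots> \<le> (\<Sum>b\<in>B. 1)" using bessel by (rule sum_mono)
  finally show ?thesis by simp
qed

text \<open>
  Take a maximal orthonormal family of eigenvectors. Its orthogonal complement contains no
  eigenvector, so it vanishes on \<open>B\<close>; applied to the residuals of the indicator vectors this is
  completeness, and no dimension count is needed.
\<close>
lemma spectral_theorem:
  assumes fin: "finite B" and herm: "is_hermitian A B"
  obtains m e l where "m \<le> card B" "eigenfamily A B m e l"
    "\<And>a b. a \<in> B \<Longrightarrow> b \<in> B \<Longrightarrow> (\<Sum>j<m. e j a * cnj (e j b)) = (if a = b then 1 else 0)"
proof -
  define P where "P m \<longleftrightarrow> (\<exists>e l. eigenfamily A B m e l)" for m
  have "P 0" by (simp add: P_def eigenfamily_def)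
  have bound: "m \<le> card B" if "P m" for m
    using that card_orthonormal_le[OF fin] unfolding P_def eigenfamily_def by blast
  define m where "m = (GREATEST m. P m)"
  have "P m" unfolding m_def using \<open>P 0\<close> bound by (rule GreatestI_nat)
  have max: "m' \<le> m" if "P m'" for m' unfolding m_def using that bound by (rule Greatest_le_nat)
  obtain e l where ef: "eigenfamily A B m e l" using \<open>P m\<close> by (auto simp: P_def)
  have on: "ip B (e i) (e j) = (if i = j then 1 else 0)" if "i < m" "j < m" for i j
    using ef that by (simp add: eigenfamily_def)
  have ev: "mat_app A B (e j) a = complex_of_real (l j) * e j a" if "j < m" "a \<in> B" for j a
    using ef that by (simp add: eigenfamily_def)
  have zero: "v a = 0" if orth: "\<And>j. j < m \<Longrightarrow> ip B (e j) v = 0" and a: "a \<in> B" for v a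
  proof (rule ccontr)
    assume "v a \<noteq> 0"
    have "\<exists>w c. ip B w w = 1 \<and> (\<forall>j<m. ip B (e j) w = 0) \<and>
        (\<forall>a\<in>B. mat_app A B w a = complex_of_real c * w a)"
      by (rule eigenvector_in_orthogonal_complement[OF fin herm ev a \<open>v a \<noteq> 0\<close> orth])
    then obtain w c where w: "ip B w w = 1" "\<And>j. j < m \<Longrightarrow> ip B (e j) w = 0"
      "\<And>a. a \<in> B \<Longrightarrow> mat_app A B w a = complex_of_real c * w a" by metis
    have w': "ip B w (e j) = 0" if "j < m" for j
      using w(2)[OF that] ip_cnj[of B "e j" w] by simp
    have "eigenfamily A B (Suc m) (e(m := w)) (l(m := c))"
      unfolding eigenfamily_def
    proof (intro conjI allI impI ballI)
      fix i j assume "i < Suc m" "j < Suc m"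
      then consider "i < m" "j < m" | "i = m" "j < m" | "i < m" "j = m" | "i = m" "j = m"
        by linarith
      then show "ip B ((e(m := w)) i) ((e(m := w)) j) = (if i = j then 1 else 0)"
        by cases (simp_all add: w(1,2) w' on)
    next
      fix j a assume "j < Suc m" "a \<in> B"
      then show "mat_app A B ((e(m := w)) j) a = complex_of_real ((l(m := c)) j) * (e(m := w)) j a"
        by (cases "j = m") (simp_all add: w(3) ev)
    qed
    then have "P (Suc m)" unfolding P_def by blast
    from max[OF this] show False by simp
  qed
  have "(\<Sum>j<m. e j a * cnj (e j b)) = (if a = b then 1 else 0)" if ab: "a \<in> B" "b \<in> B" for a b
  proof -
    define v :: "'a \<Rightarrow> complex" where "v = (\<lambda>x. if x = b then 1 else 0)"
    have ev: "ip B (e j) v = cnj (e j b)" for j unfolding v_def using fin ab(2) by (rule ip_indicator)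
    have "v a - (\<Sum>j<m. ip B (e j) v * e j a) = 0"
      using ip_orthonormal_residual[OF on] ab(1) by (rule zero)
    then have "v a = (\<Sum>j<m. cnj (e j b) * e j a)" by (simp add: ev)
    then show ?thesis by (simp add: v_def mult.commute)
  qed
  with bound[OF \<open>P m\<close>] ef show ?thesis by (rule that)
qed

text \<open>Needed to make the \<open>Max\<close> in \<open>OPT\<close> meaningful. By completeness
  an eigenvector for \<open>c\<close> has nonzero overlap with some \<open>e j\<close>, and moving
  \<open>A\<close> across the inner product forces \<open>c = l j\<close>; so the finitely many
  \<open>l j\<close> are the only candidates.\<close>

lemma eigenvalues_finite_nonempty:
  assumes fin: "finite B" and ne: "B \<noteq> {}" and herm: "is_hermitian A B"
  shows "finite {c. is_eigenvalue A B c}" "{c. is_eigenvalue A B c} \<noteq> {}"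
proof -
  obtain m e l where ef: "eigenfamily A B m e l"
    and compl: "\<And>a b. a \<in> B \<Longrightarrow> b \<in> B \<Longrightarrow> (\<Sum>j<m. e j a * cnj (e j b)) = (if a = b then 1 else 0)"
    using spectral_theorem[OF fin herm] by metis
  have ev: "mat_app A B (e j) a = complex_of_real (l j) * e j a" if "j < m" "a \<in> B" for j a
    using ef that by (simp add: eigenfamily_def)
  have "c \<in> (\<lambda>j. complex_of_real (l j)) ` {..<m}" if c: "is_eigenvalue A B c" for c
  proof -
    obtain v a0 where v: "a0 \<in> B" "v a0 \<noteq> 0" "\<And>a. a \<in> B \<Longrightarrow> mat_app A B v a = c * v a"
      using c unfolding is_eigenvalue_def mat_app_def by blast
    have "v a0 = (\<Sum>b\<in>B. (\<Sum>j<m. e j a0 * cnj (e j b)) * v b)"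
      using v(1) fin by (simp add: compl if_distrib[of "\<lambda>x. x * _"] cong: if_cong)
    also have "\<dots> = (\<Sum>j<m. e j a0 * ip B (e j) v)"
      unfolding ip_def sum_distrib_right sum_distrib_left mult.assoc by (rule sum.swap)
    finally obtain j where j: "j < m" "ip B (e j) v \<noteq> 0"
      using v(2) by (metis (no_types, lifting) lessThan_iff mult_zero_right sum.neutral)
    have "c * ip B (e j) v = ip B (e j) (mat_app A B v)"
      using v(3) by (simp add: ip_simps(3)[symmetric] cong: ip_cong)
    also have "\<dots> = ip B (mat_app A B (e j)) v" by (rule ip_mat_app_hermitian[OF herm])
    also have "\<dots> = ip B (\<lambda>a. complex_of_real (l j) * e j a) v"
      using ev[OF j(1)] by (intro ip_cong) auto
    also have "\<dots> = complex_of_real (l j) * ip B (e j) v" by (simp add: ip_simps)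
    finally show ?thesis using j by auto
  qed
  then show "finite {c. is_eigenvalue A B c}"
    by (metis finite_imageI finite_lessThan finite_subset mem_Collect_eq subsetI)
  obtain b where b: "b \<in> B" using ne by blast
  have "m > 0" using compl[OF b b] by (cases "m = 0") auto
  then have "ip B (e 0) (e 0) = 1" using ef by (simp add: eigenfamily_def)
  then obtain a where "a \<in> B" "e 0 a \<noteq> 0"
    by (metis (no_types, lifting) ip_def mult_zero_right sum.neutral zero_neq_one)
  moreover have "\<forall>a\<in>B. (\<Sum>b\<in>B. A a b * e 0 b) = complex_of_real (l 0) * e 0 a"
    using ev[OF \<open>m > 0\<close>] by (simp add: mat_app_def)
  ultimately have "is_eigenvalue A B (complex_of_real (l 0))"
    unfolding is_eigenvalue_def by blast
  then show "{c. is_eigenvalue A B c} \<noteq> {}" by blast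
qed

text \<open>The \<open>w j\<close> diagonalise the reduced density matrix \<open>\<rho>\<close> on
  \<open>X\<close>, and \<open>\<eta> j\<close> is the component of \<open>\<Psi>\<close> along
  \<open>w j\<close>. The eigenvalue equation turns the overlap of \<open>\<eta> i\<close> and
  \<open>\<eta> j\<close> into \<open>l i\<close> times that of \<open>w j\<close> and
  \<open>w i\<close>. The \<open>\<eta> j\<close> are left unnormalised, so they carry the Schmidt
  coefficients and may vanish.\<close>

lemma schmidt_decomposition:
  fixes \<Psi> :: "'a \<Rightarrow> 'b \<Rightarrow> complex"
  assumes fin: "finite X"
  obtains m w \<eta> where "m \<le> card X"
    "\<And>a z. a \<in> X \<Longrightarrow> \<Psi> a z = (\<Sum>j<m. w j a * \<eta> j z)"
    "\<And>i j. i < m \<Longrightarrow> j < m \<Longrightarrow> ip X (w i) (w j) = (if i = j then 1 else 0)"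
    "\<And>i j. i < m \<Longrightarrow> j < m \<Longrightarrow> i \<noteq> j \<Longrightarrow> ip Z (\<eta> i) (\<eta> j) = 0"
proof -
  define \<rho> where "\<rho> a b = ip Z (\<Psi> b) (\<Psi> a)" for a b
  have "is_hermitian \<rho> X" by (simp add: is_hermitian_def \<rho>_def ip_cnj)
  from spectral_theorem[OF fin this] obtain m w l where
    m: "m \<le> card X" and ef: "eigenfamily \<rho> X m w l" and
    compl: "\<And>a b. a \<in> X \<Longrightarrow> b \<in> X \<Longrightarrow> (\<Sum>j<m. w j a * cnj (w j b)) = (if a = b then 1 else 0)"
    by metis
  have on: "ip X (w i) (w j) = (if i = j then 1 else 0)" if "i < m" "j < m" for i j
    using ef that by (simp add: eigenfamily_def)
  have ev: "mat_app \<rho> X (w j) a = complex_of_real (l j) * w j a" if "j < m" "a \<in> X" for j a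
    using ef that by (simp add: eigenfamily_def)
  define \<eta> where "\<eta> j z = (\<Sum>b\<in>X. cnj (w j b) * \<Psi> b z)" for j z
  have sum: "\<Psi> a z = (\<Sum>j<m. w j a * \<eta> j z)" if "a \<in> X" for a z
  proof -
    have "\<Psi> a z = (\<Sum>b\<in>X. (\<Sum>j<m. w j a * cnj (w j b)) * \<Psi> b z)"
      using that fin by (simp add: compl if_distrib[of "\<lambda>x. x * _"] cong: if_cong)
    also have "\<dots> = (\<Sum>j<m. w j a * \<eta> j z)"
      unfolding \<eta>_def sum_distrib_right sum_distrib_left mult.assoc by (rule sum.swap)
    finally show ?thesis .
  qed
  have orth: "ip Z (\<eta> i) (\<eta> j) = 0" if ij: "i < m" "j < m" "i \<noteq> j" for i j
  proof -
    have "ip Z (\<eta> i) (\<eta> j) = (\<Sum>b\<in>X. cnj (w j b) * ip Z (\<eta> i) (\<Psi> b))"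
      unfolding \<eta>_def[of j, abs_def] by (simp add: ip_sum_right ip_simps)
    also have "\<dots> = (\<Sum>b\<in>X. cnj (w j b) * (complex_of_real (l i) * w i b))"
    proof (intro sum.cong refl arg_cong2[where f = "(*)"])
      fix b assume b: "b \<in> X"
      have "ip Z (\<Psi> b) (\<eta> i) = (\<Sum>a\<in>X. cnj (w i a) * ip Z (\<Psi> b) (\<Psi> a))"
        unfolding \<eta>_def[of i, abs_def] by (simp add: ip_sum_right ip_simps)
      then have "ip Z (\<eta> i) (\<Psi> b) = cnj (\<Sum>a\<in>X. cnj (w i a) * ip Z (\<Psi> b) (\<Psi> a))"
        by (metis ip_cnj)
      also have "\<dots> = mat_app \<rho> X (w i) b" by (simp add: mat_app_def \<rho>_def ip_cnj mult.commute)
      finally show "ip Z (\<eta> i) (\<Psi> b) = complex_of_real (l i) * w i b" using ev ij b by simp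
    qed
    also have "\<dots> = complex_of_real (l i) * ip X (w j) (w i)"
      by (simp add: ip_def sum_distrib_left mult.left_commute)
    finally show ?thesis using on ij by simp
  qed
  show ?thesis using m sum on orth by (rule that)
qed

section \<open>Local terms\<close>

lemma finite_basis_states: "finite S \<Longrightarrow> finite (basis_states S d)"
  by (simp add: basis_states_def finite_PiE)

text \<open>A basis state is determined by its restrictions to \<open>T\<close> and
  \<open>N - T\<close>, and \<open>override_on r t T\<close> glues them back. The result is
  extensional because \<open>r\<close> already takes the default value off \<open>N\<close>.\<close>

lemma sum_basis_states_split:
  assumes "T \<subseteq> N"
  shows "(\<Sum>x\<in>basis_states N d. f x) =
    (\<Sum>t\<in>basis_states T d. \<Sum>r\<in>basis_states (N - T) d. f (override_on r t T))"
proof -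
  have arb: "x i = undefined" if "x \<in> basis_states S d" "i \<notin> S" for x S i
    using that by (auto simp: basis_states_def)
  define join where "join p = override_on (snd p) (fst p) T" for p :: "(nat \<Rightarrow> nat) \<times> (nat \<Rightarrow> nat)"
  define split where "split x = (restrict x T, restrict x (N - T))" for x :: "nat \<Rightarrow> nat"
  have "(\<Sum>x\<in>basis_states N d. f x) = (\<Sum>p\<in>basis_states T d \<times> basis_states (N - T) d. f (join p))"
  proof (rule sum.reindex_bij_witness[of _ join split])
    fix x assume x: "x \<in> basis_states N d"
    show js: "join (split x) = x"
    proof
      fix i
      show "join (split x) i = x i"
        using arb[OF x, of i] assms by (cases "i \<in> N") (auto simp: join_def split_def override_on_def)
    qed
    show "split x \<in> basis_states T d \<times> basis_states (N - T) d"
      using x assms by (auto simp: split_def basis_states_def)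
    show "f (join (split x)) = f x" by (simp add: js)
  next
    fix p assume "p \<in> basis_states T d \<times> basis_states (N - T) d"
    then obtain t r where p: "p = (t, r)" and t: "t \<in> basis_states T d" and r: "r \<in> basis_states (N - T) d"
      by auto
    have "restrict (override_on r t T) T i = t i" for i
      using arb[OF t, of i] by (cases "i \<in> T") auto
    moreover have "restrict (override_on r t T) (N - T) i = r i" for i
      using arb[OF r, of i] by (cases "i \<in> N - T") auto
    ultimately show "split (join p) = p" by (simp add: p join_def split_def fun_eq_iff)
    show "join p \<in> basis_states N d"
      unfolding basis_states_def
    proof (rule PiE_I)
      fix i assume "i \<in> N"
      then show "join p i \<in> {0..<d}"
        using PiE_mem[of t T "\<lambda>_. {0..<d}" i] PiE_mem[of r "N - T" "\<lambda>_. {0..<d}" i] t r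
        by (cases "i \<in> T") (simp_all add: p join_def basis_states_def)
    next
      fix i assume "i \<notin> N"
      then show "join p i = undefined"
        using arb[OF r, of i] assms by (cases "i \<in> T") (auto simp: p join_def)
    qed
  qed
  then show ?thesis by (simp add: join_def sum.cartesian_product split_beta)
qed

lemma sum_basis_states_singleton:
  "(\<Sum>t\<in>basis_states {m} d. f (t m)) = (\<Sum>a<d. f a)"
  by (rule sum.reindex_bij_witness[of _ "\<lambda>a. (\<lambda>i\<in>{m}. a)" "\<lambda>t. t m"])
    (auto simp: basis_states_def fun_eq_iff PiE_def extensional_def Pi_def)

text \<open>A term acting as the identity on \<open>T\<close> is block diagonal in the
  \<open>T\<close> coordinates, with the same block for every \<open>t\<close>. Writing the block
  with support \<open>S \<union> T\<close> removes \<open>T\<close> from the agreement test of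
  \<open>embed_local\<close>; the inner restrictions to \<open>S\<close> keep its matrix independent
  of \<open>T\<close>.\<close>

lemma sesq_embed_local_split:
  assumes T: "T \<subseteq> {0..<n} - S" and S: "S \<subseteq> {0..<n}"
  shows "sesq (embed_local n S A) (basis_states {0..<n} d) u v =
    (\<Sum>t\<in>basis_states T d. sesq (embed_local n (S \<union> T) (\<lambda>x y. A (restrict x S) (restrict y S)))
      (basis_states ({0..<n} - T) d) (\<lambda>r. u (override_on r t T)) (\<lambda>r. v (override_on r t T)))"
proof -
  define R where "R = basis_states ({0..<n} - T) d"
  define E where "E = embed_local n (S \<union> T) (\<lambda>x y. A (restrict x S) (restrict y S))"
  have TN: "T \<subseteq> {0..<n}" using T by blast
  have finT: "finite (basis_states T d)"
    using TN by (intro finite_basis_states) (rule finite_subset, auto)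
  have emb: "embed_local n S A (override_on r t T) (override_on r' t' T) = (if t = t' then E r r' else 0)"
    if t: "t \<in> basis_states T d" "t' \<in> basis_states T d" for t t' r r'
  proof (cases "t = t'")
    case True
    have "(\<forall>i\<in>{0..<n} - S. override_on r t T i = override_on r' t' T i) \<longleftrightarrow>
        (\<forall>i\<in>{0..<n} - (S \<union> T). r i = r' i)"
      using True by (auto simp: override_on_def)
    moreover have "restrict (override_on x t T) S = restrict (restrict x (S \<union> T)) S" for x t :: "nat \<Rightarrow> nat"
      using T by (auto simp: override_on_def restrict_def fun_eq_iff)
    ultimately show ?thesis using True by (simp add: embed_local_def E_def)
  next
    case False
    have "t i = t' i" if "i \<notin> T" for i
      using t that by (simp add: basis_states_def PiE_def extensional_def)
    with False obtain i where "i \<in> T" "t i \<noteq> t' i" by (auto simp: fun_eq_iff)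
    then have "i \<in> {0..<n} - S" "override_on r t T i \<noteq> override_on r' t' T i"
      using T by auto
    then have ne: "\<not> (\<forall>i\<in>{0..<n} - S. override_on r t T i = override_on r' t' T i)" by blast
    show ?thesis unfolding embed_local_def if_not_P[OF ne] using False by simp
  qed
  have "sesq (embed_local n S A) (basis_states {0..<n} d) u v =
      (\<Sum>t\<in>basis_states T d. \<Sum>r\<in>R. \<Sum>t'\<in>basis_states T d. \<Sum>r'\<in>R.
        cnj (u (override_on r t T)) * (if t = t' then E r r' else 0) * v (override_on r' t' T))"
    unfolding sesq_def sum_basis_states_split[OF TN] R_def[symmetric]
    by (intro sum.cong refl) (simp add: emb)
  also have "\<dots> = (\<Sum>t\<in>basis_states T d. \<Sum>r\<in>R. \<Sum>t'\<in>basis_states T d. if t = t' then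
        (\<Sum>r'\<in>R. cnj (u (override_on r t T)) * E r r' * v (override_on r' t' T)) else 0)"
    by (intro sum.cong refl) auto
  also have "\<dots> = (\<Sum>t\<in>basis_states T d. \<Sum>r\<in>R. \<Sum>r'\<in>R.
        cnj (u (override_on r t T)) * E r r' * v (override_on r' t T))"
    by (simp add: finT)
  finally show ?thesis by (simp add: sesq_def R_def E_def)
qed

text \<open>With \<open>T\<close> the whole complement of \<open>S\<close>, every block in the
  splitting is \<open>A\<close> itself, so the form is a sum of nonnegative values of
  \<open>qform A\<close>.\<close>

lemma sesq_embed_local_psd:
  assumes "is_psd A (basis_states S d)" and S: "S \<subseteq> {0..<n}"
  shows "Re (sesq (embed_local n S A) (basis_states {0..<n} d) v v) \<ge> 0"
proof -
  define T where "T = {0..<n} - S"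
  have T: "T \<subseteq> {0..<n} - S" by (simp add: T_def)
  have eq: "{0..<n} - T = S" "{0..<n} - (S \<union> T) = {}" "S \<union> T = {0..<n}" using S by (auto simp: T_def)
  have "embed_local n (S \<union> T) (\<lambda>x y. A (restrict x S) (restrict y S)) a b = A a b"
    if "a \<in> basis_states S d" "b \<in> basis_states S d" for a b
  proof -
    have "restrict (restrict x (S \<union> T)) S = x" if "x \<in> basis_states S d" for x
      using that by (auto simp: basis_states_def fun_eq_iff PiE_def extensional_def)
    with that show ?thesis by (simp add: embed_local_def eq(2))
  qed
  then have "sesq (embed_local n (S \<union> T) (\<lambda>x y. A (restrict x S) (restrict y S))) (basis_states S d) u u
      = qform A (basis_states S d) u" for u
    by (simp add: sesq_def qform_def)
  then show ?thesis
    using assms unfolding sesq_embed_local_split[OF T S] eq(1) by (simp add: is_psd_def sum_nonneg)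
qed

text \<open>On vectors that factor across \<open>T\<close>, the form is the overlap of the
  \<open>T\<close> factors times the form of the rest. All cross terms between Schmidt branches are
  removed through this lemma.\<close>

lemma sesq_embed_local_orthogonal:
  assumes T: "T \<subseteq> {0..<n} - S" and S: "S \<subseteq> {0..<n}"
    and u: "\<And>r t. t \<in> basis_states T d \<Longrightarrow> u (override_on r t T) = p r * f t"
    and v: "\<And>r t. t \<in> basis_states T d \<Longrightarrow> v (override_on r t T) = q r * g t"
    and orth: "ip (basis_states T d) f g = 0"
  shows "sesq (embed_local n S A) (basis_states {0..<n} d) u v = 0"
proof -
  define K where "K = sesq (embed_local n (S \<union> T) (\<lambda>x y. A (restrict x S) (restrict y S)))
      (basis_states ({0..<n} - T) d)"
  have "K (\<lambda>r. p r * c) (\<lambda>r. q r * c') = cnj c * c' * K p q" for c c'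
    unfolding K_def sesq_def sum_distrib_left by (intro sum.cong refl) (simp add: mult_ac)
  then have "sesq (embed_local n S A) (basis_states {0..<n} d) u v =
      (\<Sum>t\<in>basis_states T d. cnj (f t) * g t * K p q)"
    unfolding sesq_embed_local_split[OF T S] K_def[symmetric] using u v by (simp cong: sum.cong)
  also have "\<dots> = ip (basis_states T d) f g * K p q"
    by (simp add: ip_def sum_distrib_right)
  finally show ?thesis using orth by simp
qed

section \<open>Quadratic forms of a sum of vectors\<close>

lemma sesq_diff:
  "sesq A B (\<lambda>a. u a - v a) (\<lambda>a. u a - v a) = sesq A B u u - sesq A B u v - sesq A B v u + sesq A B v v"
  unfolding sesq_def sum_subtractf[symmetric] sum.distrib[symmetric]
  by (intro sum.cong refl) (simp add: algebra_simps)

lemma sesq_sum: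
  fixes m :: nat
  assumes "\<And>a. a \<in> B \<Longrightarrow> v a = (\<Sum>j<m. w j a)"
  shows "sesq A B v v = (\<Sum>i<m. \<Sum>j<m. sesq A B (w i) (w j))"
proof -
  have "sesq A B v v = (\<Sum>a\<in>B. \<Sum>b\<in>B. \<Sum>i<m. \<Sum>j<m. cnj (w i a) * A a b * w j b)"
    unfolding sesq_def by (intro sum.cong refl)
      (simp add: assms sum_distrib_left sum_distrib_right, rule sum.swap)
  also have "\<dots> = (\<Sum>a\<in>B. \<Sum>i<m. \<Sum>b\<in>B. \<Sum>j<m. cnj (w i a) * A a b * w j b)"
    by (rule sum.cong[OF refl sum.swap])
  also have "\<dots> = (\<Sum>i<m. \<Sum>a\<in>B. \<Sum>b\<in>B. \<Sum>j<m. cnj (w i a) * A a b * w j b)"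
    by (rule sum.swap)
  also have "\<dots> = (\<Sum>i<m. \<Sum>a\<in>B. \<Sum>j<m. \<Sum>b\<in>B. cnj (w i a) * A a b * w j b)"
    by (rule sum.cong[OF refl sum.cong[OF refl sum.swap]])
  also have "\<dots> = (\<Sum>i<m. \<Sum>j<m. \<Sum>a\<in>B. \<Sum>b\<in>B. cnj (w i a) * A a b * w j b)"
    by (rule sum.cong[OF refl sum.swap])
  finally show ?thesis by (simp add: sesq_def)
qed

lemma sesq_sum_orthogonal:
  fixes m :: nat
  assumes "\<And>a. a \<in> B \<Longrightarrow> v a = (\<Sum>j<m. w j a)"
    and "\<And>i j. i < m \<Longrightarrow> j < m \<Longrightarrow> i \<noteq> j \<Longrightarrow> sesq A B (w i) (w j) = 0"
  shows "sesq A B v v = (\<Sum>j<m. sesq A B (w j) (w j))"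
proof -
  have "sesq A B v v = (\<Sum>i<m. \<Sum>j<m. sesq A B (w i) (w j))" by (rule sesq_sum[OF assms(1)])
  also have "\<dots> = (\<Sum>i<m. \<Sum>j<m. if i = j then sesq A B (w i) (w i) else 0)"
    using assms(2) by (intro sum.cong refl) auto
  finally show ?thesis by simp
qed

text \<open>Summing the nonnegative numbers \<open>sesq A B (w i - w j) (w i - w j)\<close> over all pairs.\<close>
lemma pinching_inequality:
  fixes m :: nat
  assumes "\<And>a. a \<in> B \<Longrightarrow> v a = (\<Sum>j<m. w j a)"
    and psd: "\<And>u. Re (sesq A B u u) \<ge> 0"
  shows "Re (sesq A B v v) \<le> real m * (\<Sum>j<m. Re (sesq A B (w j) (w j)))"
proof -
  define q where "q i j = Re (sesq A B (w i) (w j))" for i j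
  have "sesq A B v v = (\<Sum>i<m. \<Sum>j<m. sesq A B (w i) (w j))" by (rule sesq_sum[OF assms(1)])
  then have tot: "Re (sesq A B v v) = (\<Sum>i<m. \<Sum>j<m. q i j)" by (simp add: q_def)
  have "0 \<le> q i i - q i j - q j i + q j j" for i j
    using psd[of "\<lambda>a. w i a - w j a"] unfolding sesq_diff by (simp add: q_def)
  then have "0 \<le> (\<Sum>i<m. \<Sum>j<m. q i i - q i j - q j i + q j j)"
    by (intro sum_nonneg)
  also have "\<dots> = (\<Sum>i<m. \<Sum>j<m. q i i) - (\<Sum>i<m. \<Sum>j<m. q i j)
      - (\<Sum>i<m. \<Sum>j<m. q j i) + (\<Sum>i<m. \<Sum>j<m. q j j)"
    by (simp only: sum.distrib sum_subtractf)
  finally have "(\<Sum>i<m. \<Sum>j<m. q i j) + (\<Sum>i<m. \<Sum>j<m. q j i)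
      \<le> (\<Sum>i<m. \<Sum>j<m. q i i) + (\<Sum>i<m. \<Sum>j<m. q j j)"
    by linarith
  moreover have "(\<Sum>i<m. \<Sum>j<m. q j i) = (\<Sum>i<m. \<Sum>j<m. q i j)" by (rule sum.swap)
  moreover have "(\<Sum>i<m. \<Sum>j<m. q i i) = real m * (\<Sum>j<m. q j j)"
    "(\<Sum>i<m. \<Sum>j<m. q j j) = real m * (\<Sum>j<m. q j j)"
    by (simp_all add: sum_distrib_left)
  ultimately have "(\<Sum>i<m. \<Sum>j<m. q i j) \<le> real m * (\<Sum>j<m. q j j)"
    by linarith
  then show ?thesis by (simp add: tot q_def)
qed

section \<open>Disentangling one qudit at a time\<close>

text \<open>The states of the induction: qudits below \<open>m\<close> have fixed factors, while
  \<open>\<psi>\<close> is an arbitrary, possibly entangled and unnormalised vector of the others.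
  It interpolates between an arbitrary vector at \<open>m = 0\<close> and a scalar multiple of a
  product state at \<open>m = n\<close>.\<close>

definition partial_product :: "nat \<Rightarrow> nat \<Rightarrow> (nat \<Rightarrow> nat \<Rightarrow> complex) \<Rightarrow> ((nat \<Rightarrow> nat) \<Rightarrow> complex) \<Rightarrow> (nat \<Rightarrow> nat) \<Rightarrow> complex" where
  "partial_product n m \<phi> \<psi> x = (\<Prod>i<m. \<phi> i (x i)) * \<psi> (restrict x {m..<n})"

text \<open>
  A term with \<open>r\<close> unprocessed qudits can still lose a factor \<open>d\<close> at all of them but the last;
  truncated subtraction gives weight 1 when \<open>r = 0\<close> as well.
\<close>
definition site_weight :: "nat \<Rightarrow> nat \<Rightarrow> nat \<Rightarrow> nat set \<Rightarrow> real" where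
  "site_weight n d m S = 1 / real d ^ (card (S \<inter> {m..<n}) - 1)"

text \<open>Only \<open>\<psi>\<close> is decomposed, cut between qudit \<open>m\<close> and the
  later ones; the factors before \<open>m\<close> are common to all branches. Cross terms can
  survive only for a term that acts on \<open>m\<close> and on a later qudit. Since the
  \<open>w j\<close> are unit vectors, the weight of a branch sits in
  \<open>\<eta> j\<close>.\<close>

lemma schmidt_site:
  assumes mn: "m < n"
  obtains M w \<eta> where "M \<le> d" "\<And>j. j < M \<Longrightarrow> unit_vec d (w j)"
    "\<And>x. x \<in> basis_states {0..<n} d \<Longrightarrow> partial_product n m \<phi> \<psi> x =
       (\<Sum>j<M. partial_product n (Suc m) (\<phi>(m := w j)) (\<eta> j) x)"
    "\<And>S A i j. S \<subseteq> {0..<n} \<Longrightarrow> m \<notin> S \<or> S \<inter> {Suc m..<n} = {} \<Longrightarrow> i < M \<Longrightarrow> j < M \<Longrightarrow> i \<noteq> j \<Longrightarrow>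
       sesq (embed_local n S A) (basis_states {0..<n} d)
         (partial_product n (Suc m) (\<phi>(m := w i)) (\<eta> i))
         (partial_product n (Suc m) (\<phi>(m := w j)) (\<eta> j)) = 0"
proof -
  obtain M w \<eta> where M: "M \<le> card {..<d}"
    and decomp: "\<And>a z. a \<in> {..<d} \<Longrightarrow> \<psi> (z(m := a)) = (\<Sum>j<M. w j a * \<eta> j z)"
    and w_on: "\<And>i j. i < M \<Longrightarrow> j < M \<Longrightarrow> ip {..<d} (w i) (w j) = (if i = j then 1 else 0)"
    and \<eta>_orth: "\<And>i j. i < M \<Longrightarrow> j < M \<Longrightarrow> i \<noteq> j \<Longrightarrow> ip (basis_states {Suc m..<n} d) (\<eta> i) (\<eta> j) = 0"
    by (rule schmidt_decomposition[where X = "{..<d}" and \<Psi> = "\<lambda>a z. \<psi> (z(m := a))"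
          and Z = "basis_states {Suc m..<n} d", OF finite_lessThan]) (rule that)
  define v where "v j = partial_product n (Suc m) (\<phi>(m := w j)) (\<eta> j)" for j
  have v_eq: "v j x = (\<Prod>i<m. \<phi> i (x i)) * w j (x m) * \<eta> j (restrict x {Suc m..<n})" for j x
  proof -
    have "(\<Prod>i<m. (\<phi>(m := w j)) i (x i)) = (\<Prod>i<m. \<phi> i (x i))" by (rule prod.cong) auto
    then show ?thesis by (simp add: v_def partial_product_def)
  qed
  have unit: "unit_vec d (w j)" if "j < M" for j
    using w_on[OF that that] Re_ip_self[of "{..<d}" "w j"] by (simp add: unit_vec_def)
  have sum: "partial_product n m \<phi> \<psi> x = (\<Sum>j<M. v j x)" if x: "x \<in> basis_states {0..<n} d" for x
  proof -
    have "x m \<in> {..<d}" using x mn by (auto simp: basis_states_def)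
    moreover have "restrict x {m..<n} = (restrict x {Suc m..<n})(m := x m)"
      using mn by (auto simp: fun_eq_iff restrict_def)
    ultimately have "\<psi> (restrict x {m..<n}) = (\<Sum>j<M. w j (x m) * \<eta> j (restrict x {Suc m..<n}))"
      by (simp only: decomp)
    then show ?thesis by (simp add: partial_product_def v_eq sum_distrib_left mult.assoc)
  qed
  \<comment> \<open>The cut is at \<open>{m}\<close>, where the term is the identity, so the overlap
    of \<open>w i\<close> and \<open>w j\<close> splits off.\<close>
  have orth1: "sesq (embed_local n S A) (basis_states {0..<n} d) (v i) (v j) = 0"
    if S: "S \<subseteq> {0..<n}" "m \<notin> S" and ij: "i < M" "j < M" "i \<noteq> j" for S A i j
  proof (rule sesq_embed_local_orthogonal)
    show "{m} \<subseteq> {0..<n} - S" "S \<subseteq> {0..<n}" using S mn by auto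
    have eq: "v j (override_on r t {m}) =
        ((\<Prod>i<m. \<phi> i (r i)) * \<eta> j (restrict r {Suc m..<n})) * w j (t m)" for j r t
    proof -
      have "restrict (override_on r t {m}) {Suc m..<n} = restrict r {Suc m..<n}"
        by (auto simp: fun_eq_iff restrict_def)
      moreover have "(\<Prod>i<m. \<phi> i (override_on r t {m} i)) = (\<Prod>i<m. \<phi> i (r i))"
        by (rule prod.cong) auto
      ultimately show ?thesis by (simp add: v_eq)
    qed
    show "v i (override_on r t {m}) = ((\<Prod>i<m. \<phi> i (r i)) * \<eta> i (restrict r {Suc m..<n})) * w i (t m)" for r t
      by (rule eq)
    show "v j (override_on r t {m}) = ((\<Prod>i<m. \<phi> i (r i)) * \<eta> j (restrict r {Suc m..<n})) * w j (t m)" for r t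
      by (rule eq)
    have "ip (basis_states {m} d) (\<lambda>t. w i (t m)) (\<lambda>t. w j (t m)) = ip {..<d} (w i) (w j)"
      unfolding ip_def by (rule sum_basis_states_singleton)
    then show "ip (basis_states {m} d) (\<lambda>t. w i (t m)) (\<lambda>t. w j (t m)) = 0"
      using w_on ij by simp
  qed
  \<comment> \<open>Here the cut is at all later qudits and the overlap of \<open>\<eta> i\<close>
    and \<open>\<eta> j\<close> splits off; \<open>w j\<close> stays in the other factor because
    \<open>S\<close> may contain \<open>m\<close>.\<close>
  have orth2: "sesq (embed_local n S A) (basis_states {0..<n} d) (v i) (v j) = 0"
    if S: "S \<subseteq> {0..<n}" "S \<inter> {Suc m..<n} = {}" and ij: "i < M" "j < M" "i \<noteq> j" for S A i j
  proof (rule sesq_embed_local_orthogonal)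
    let ?T = "{Suc m..<n}"
    show "?T \<subseteq> {0..<n} - S" "S \<subseteq> {0..<n}" using S by auto
    have eq: "v j (override_on r t ?T) = ((\<Prod>i<m. \<phi> i (r i)) * w j (r m)) * \<eta> j t"
      if "t \<in> basis_states ?T d" for j r t
    proof -
      have "restrict (override_on r t ?T) ?T = t"
        using that by (auto simp: basis_states_def fun_eq_iff PiE_def extensional_def override_on_def)
      moreover have "(\<Prod>i<m. \<phi> i (override_on r t ?T i)) = (\<Prod>i<m. \<phi> i (r i))"
        by (rule prod.cong) auto
      ultimately show ?thesis by (simp add: v_eq)
    qed
    show "v i (override_on r t ?T) = ((\<Prod>i<m. \<phi> i (r i)) * w i (r m)) * \<eta> i t"
      if "t \<in> basis_states ?T d" for r t using that by (rule eq)
    show "v j (override_on r t ?T) = ((\<Prod>i<m. \<phi> i (r i)) * w j (r m)) * \<eta> j t"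
      if "t \<in> basis_states ?T d" for r t using that by (rule eq)
    show "ip (basis_states ?T d) (\<eta> i) (\<eta> j) = 0" using \<eta>_orth ij by simp
  qed
  have orth: "sesq (embed_local n S A) (basis_states {0..<n} d) (v i) (v j) = 0"
    if "S \<subseteq> {0..<n}" "m \<notin> S \<or> S \<inter> {Suc m..<n} = {}" "i < M" "j < M" "i \<noteq> j" for S A i j
    using that orth1 orth2 by blast
  have "M \<le> d" using M by simp
  from this unit sum[unfolded v_def] orth[unfolded v_def] show ?thesis by (rule that)
qed

text \<open>Treating the inner product as a local term with empty support lets the orthogonality
  results for terms also give additivity of the squared norm over branches.\<close>

lemma sesq_identity:
  "sesq (embed_local n {} (\<lambda>_ _. 1)) (basis_states {0..<n} d) u v = ip (basis_states {0..<n} d) u v"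
proof -
  have "embed_local n {} (\<lambda>_ _. 1) x y = (if x = y then 1 else 0)"
    if "x \<in> basis_states {0..<n} d" "y \<in> basis_states {0..<n} d" for x y
    using that by (auto simp: embed_local_def basis_states_def intro: PiE_ext)
  then have "sesq (embed_local n {} (\<lambda>_ _. 1)) (basis_states {0..<n} d) u v =
      (\<Sum>x\<in>basis_states {0..<n} d. \<Sum>y\<in>basis_states {0..<n} d. if x = y then cnj (u x) * v y else 0)"
    unfolding sesq_def by (intro sum.cong refl) simp
  then show ?thesis by (simp add: ip_def finite_basis_states)
qed

text \<open>Another qudit of \<open>S\<close> remains after \<open>m\<close>, so the truncated
  subtraction does not truncate and the exponent drops by exactly one.\<close>

lemma site_weight_step:
  assumes "d \<ge> 1" "m < n" "S \<subseteq> {0..<n}" "m \<in> S" "S \<inter> {Suc m..<n} \<noteq> {}"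
  shows "site_weight n d (Suc m) S = real d * site_weight n d m S"
proof -
  have "S \<inter> {m..<n} = insert m (S \<inter> {Suc m..<n})" using assms by auto
  then have "card (S \<inter> {m..<n}) = Suc (card (S \<inter> {Suc m..<n}))" by simp
  moreover have "card (S \<inter> {Suc m..<n}) \<noteq> 0" using assms by simp
  ultimately show ?thesis using assms(1)
    by (cases "card (S \<inter> {Suc m..<n})") (simp_all add: site_weight_def)
qed

text \<open>If \<open>m\<close> is the last unprocessed qudit of \<open>S\<close>, the count goes
  from 1 to 0 and truncation keeps the exponent at 0; if \<open>m\<close> is not in
  \<open>S\<close>, the count does not change.\<close>

lemma site_weight_same:
  assumes "m \<notin> S \<or> S \<inter> {Suc m..<n} = {}"
  shows "site_weight n d (Suc m) S = site_weight n d m S"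
proof (cases "m \<in> S")
  case True
  then have "S \<inter> {Suc m..<n} = {}" using assms by simp
  moreover have "S \<inter> {m..<n} \<subseteq> insert m (S \<inter> {Suc m..<n})" by auto
  ultimately have "S \<inter> {m..<n} \<subseteq> {m}" by simp
  then have "card (S \<inter> {m..<n}) \<le> 1" using card_mono[of "{m}"] by fastforce
  with \<open>S \<inter> {Suc m..<n} = {}\<close> show ?thesis by (simp add: site_weight_def)
next
  case False
  then have "S \<inter> {m..<n} = S \<inter> {Suc m..<n}" by (auto simp: Suc_le_eq le_less)
  then show ?thesis by (simp add: site_weight_def)
qed

text \<open>The potential of the induction: each term is discounted in advance by every loss it can
  still suffer. At \<open>m = n\<close> it is the plain value.\<close>

definition weighted_value ::
  "nat \<Rightarrow> nat \<Rightarrow> nat set set \<Rightarrow> (nat set \<Rightarrow> (nat \<Rightarrow> nat) \<Rightarrow> (nat \<Rightarrow> nat) \<Rightarrow> complex) \<Rightarrow>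
    nat \<Rightarrow> ((nat \<Rightarrow> nat) \<Rightarrow> complex) \<Rightarrow> real" where
  "weighted_value n d F h m v =
     (\<Sum>S\<in>F. site_weight n d m S * Re (sesq (embed_local n S (h S)) (basis_states {0..<n} d) v v))"

text \<open>A Rayleigh quotient bound with the denominator cleared. It is invariant under nonzero
  scaling, so branches need no normalisation.\<close>

definition achieves ::
  "nat \<Rightarrow> nat \<Rightarrow> nat set set \<Rightarrow> (nat set \<Rightarrow> (nat \<Rightarrow> nat) \<Rightarrow> (nat \<Rightarrow> nat) \<Rightarrow> complex) \<Rightarrow> real \<Rightarrow>
    nat \<Rightarrow> ((nat \<Rightarrow> nat) \<Rightarrow> complex) \<Rightarrow> bool" where
  "achieves n d F h c m v \<longleftrightarrow>
     Re (ip (basis_states {0..<n} d) v v) > 0 \<and>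
     weighted_value n d F h m v \<ge> c * Re (ip (basis_states {0..<n} d) v v)"

text \<open>Averaging: the squared norms of the branches add up to that of \<open>v\<close>, and
  their potentials add up to at least its potential, so some nonzero branch has quotient at least
  \<open>c\<close>.\<close>

lemma partial_product_step:
  assumes d: "d \<ge> 1" and mn: "m < n"
    and F: "\<And>S. S \<in> F \<Longrightarrow> S \<subseteq> {0..<n} \<and> is_psd (h S) (basis_states S d)"
    and ach: "achieves n d F h c m (partial_product n m \<phi> \<psi>)"
  shows "\<exists>u \<eta>. unit_vec d u \<and> achieves n d F h c (Suc m) (partial_product n (Suc m) (\<phi>(m := u)) \<eta>)"
proof -
  define B where "B = basis_states {0..<n} d"
  define W where "W = weighted_value n d F h"
  have W_sum: "W m v = (\<Sum>S\<in>F. site_weight n d m S * Re (sesq (embed_local n S (h S)) B v v))" for m v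
    by (simp add: W_def weighted_value_def B_def)
  obtain M w \<eta> where M: "M \<le> d" and unit: "\<And>j. j < M \<Longrightarrow> unit_vec d (w j)"
    and decomp: "\<And>x. x \<in> basis_states {0..<n} d \<Longrightarrow> partial_product n m \<phi> \<psi> x =
       (\<Sum>j<M. partial_product n (Suc m) (\<phi>(m := w j)) (\<eta> j) x)"
    and orth: "\<And>S A i j. S \<subseteq> {0..<n} \<Longrightarrow> m \<notin> S \<or> S \<inter> {Suc m..<n} = {} \<Longrightarrow> i < M \<Longrightarrow> j < M \<Longrightarrow> i \<noteq> j \<Longrightarrow>
       sesq (embed_local n S A) (basis_states {0..<n} d)
         (partial_product n (Suc m) (\<phi>(m := w i)) (\<eta> i))
         (partial_product n (Suc m) (\<phi>(m := w j)) (\<eta> j)) = 0"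
    by (rule schmidt_site[OF mn, where d = d and \<phi> = \<phi> and \<psi> = \<psi>]) (rule that)
  define v where "v = partial_product n m \<phi> \<psi>"
  define v' where "v' j = partial_product n (Suc m) (\<phi>(m := w j)) (\<eta> j)" for j
  have dec: "v x = (\<Sum>j<M. v' j x)" if "x \<in> B" for x using decomp that by (simp add: v_def v'_def B_def)
  have orth': "sesq (embed_local n S A) B (v' i) (v' j) = 0"
    if "S \<subseteq> {0..<n}" "m \<notin> S \<or> S \<inter> {Suc m..<n} = {}" "i < M" "j < M" "i \<noteq> j" for S A i j
    using orth[OF that] by (simp add: v'_def B_def)
  define N where "N u = Re (ip B u u)" for u
  have pos: "N v > 0" and ge: "W m v \<ge> c * N v"
    using ach by (simp_all add: achieves_def v_def N_def B_def W_def)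
  have N: "N v = (\<Sum>j<M. N (v' j))"
    using sesq_sum_orthogonal[OF dec orth', of "{}" "\<lambda>_ _. 1"]
    by (simp add: N_def B_def sesq_identity)
  \<comment> \<open>Either the cross terms vanish and the weight is unchanged, or pinching costs a
    factor \<open>M \<le> d\<close>, which the growth of the weight by \<open>d\<close> pays
    for.\<close>
  have each: "site_weight n d m S * Re (sesq (embed_local n S (h S)) B v v)
      \<le> (\<Sum>j<M. site_weight n d (Suc m) S * Re (sesq (embed_local n S (h S)) B (v' j) (v' j)))"
    if S: "S \<in> F" for S
  proof -
    let ?q = "\<lambda>u. Re (sesq (embed_local n S (h S)) B u u)"
    have psd: "?q u \<ge> 0" for u using F[OF S] sesq_embed_local_psd unfolding B_def by blast
    have wt: "site_weight n d m S \<ge> 0" by (simp add: site_weight_def)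
    show ?thesis
    proof (cases "m \<notin> S \<or> S \<inter> {Suc m..<n} = {}")
      case True
      have "sesq (embed_local n S (h S)) B v v = (\<Sum>j<M. sesq (embed_local n S (h S)) B (v' j) (v' j))"
        using dec orth' F[OF S] True by (intro sesq_sum_orthogonal) auto
      then show ?thesis using site_weight_same[OF True] by (simp add: sum_distrib_left)
    next
      case False
      have "?q v \<le> real M * (\<Sum>j<M. ?q (v' j))" using dec psd by (rule pinching_inequality)
      also have "\<dots> \<le> real d * (\<Sum>j<M. ?q (v' j))"
        using M psd by (intro mult_right_mono sum_nonneg) auto
      finally have "site_weight n d m S * ?q v \<le> site_weight n d m S * (real d * (\<Sum>j<M. ?q (v' j)))"
        using wt by (rule mult_left_mono)
      moreover have "site_weight n d (Suc m) S = real d * site_weight n d m S"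
        using d mn F[OF S] False by (intro site_weight_step) auto
      ultimately show ?thesis by (simp add: sum_distrib_left[symmetric] mult_ac)
    qed
  qed
  have "W m v \<le> (\<Sum>S\<in>F. \<Sum>j<M. site_weight n d (Suc m) S * Re (sesq (embed_local n S (h S)) B (v' j) (v' j)))"
    unfolding W_sum using each by (rule sum_mono)
  also have "\<dots> = (\<Sum>j<M. W (Suc m) (v' j))" unfolding W_sum by (rule sum.swap)
  finally have WN: "0 \<le> (\<Sum>j<M. W (Suc m) (v' j) - c * N (v' j))"
    using ge N by (simp add: sum_subtractf sum_distrib_left)
  \<comment> \<open>Branches of norm zero contribute nothing to the average, so the good branch can
    be sought among the others.\<close>
  have zero: "W (Suc m) (v' j) = 0" if "N (v' j) = 0" for j
  proof -
    have "v' j x = 0" if "x \<in> B" for x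
      using ip_self_eq_0[of B "v' j"] \<open>N (v' j) = 0\<close> that by (simp add: N_def B_def finite_basis_states)
    then show ?thesis by (simp add: W_sum sesq_def)
  qed
  have Nge: "N u \<ge> 0" for u by (simp add: N_def Re_ip_self_ge_0)
  have "\<exists>j<M. N (v' j) > 0 \<and> W (Suc m) (v' j) \<ge> c * N (v' j)"
  proof (rule ccontr)
    assume "\<not> ?thesis"
    then have neg: "W (Suc m) (v' j) < c * N (v' j)" if "j < M" "N (v' j) > 0" for j
      using that by force
    have "(\<Sum>j<M. N (v' j)) > 0" using pos N by simp
    then obtain j0 where j0: "j0 < M" "N (v' j0) > 0"
      by (metis lessThan_iff not_less sum_nonpos)
    have "(\<Sum>j<M. W (Suc m) (v' j) - c * N (v' j)) < (\<Sum>j<M. 0)"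
    proof (rule sum_strict_mono_ex1)
      show "\<forall>j\<in>{..<M}. W (Suc m) (v' j) - c * N (v' j) \<le> 0"
      proof
        fix j assume "j \<in> {..<M}"
        then show "W (Suc m) (v' j) - c * N (v' j) \<le> 0"
          using neg[of j] zero[of j] Nge[of "v' j"] by (cases "N (v' j) = 0") auto
      qed
      show "\<exists>j\<in>{..<M}. W (Suc m) (v' j) - c * N (v' j) < 0"
        using j0 neg[OF j0] by (intro bexI[of _ j0]) auto
    qed simp
    with WN show False by simp
  qed
  then obtain j where "j < M" "N (v' j) > 0" "W (Suc m) (v' j) \<ge> c * N (v' j)" by blast
  then have "unit_vec d (w j)" "achieves n d F h c (Suc m) (v' j)"
    using unit by (simp_all add: achieves_def N_def B_def W_def)
  then show ?thesis unfolding v'_def by blast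
qed

section \<open>Product states, attainment of the optimum and the final induction\<close>

lemma norm_product_state:
  assumes "\<And>i. i < n \<Longrightarrow> unit_vec d (\<phi> i)"
  shows "Re (ip (basis_states {0..<n} d) (product_state n \<phi>) (product_state n \<phi>)) = 1"
proof -
  have "Re (ip (basis_states {0..<n} d) (product_state n \<phi>) (product_state n \<phi>)) =
      (\<Sum>x\<in>PiE {..<n} (\<lambda>_. {..<d}). \<Prod>i<n. (cmod (\<phi> i (x i)))\<^sup>2)"
    by (simp add: Re_ip_self basis_states_def product_state_def prod_norm[symmetric]
        prod_power_distrib atLeast0LessThan)
  also have "\<dots> = (\<Prod>i<n. \<Sum>a<d. (cmod (\<phi> i a))\<^sup>2)"
    by (rule prod_sum_PiE[symmetric]) auto
  also have "\<dots> = 1" using assms by (simp add: unit_vec_def)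
  finally show ?thesis .
qed

lemma sesq_hamiltonian:
  "sesq (hamiltonian n k h) B u v = (\<Sum>S\<in>k_subsets n k. sesq (embed_local n S (h S)) B u v)"
proof -
  have "sesq (hamiltonian n k h) B u v =
      (\<Sum>a\<in>B. \<Sum>S\<in>k_subsets n k. \<Sum>b\<in>B. cnj (u a) * embed_local n S (h S) a b * v b)"
    unfolding sesq_def hamiltonian_def sum_distrib_left sum_distrib_right
    by (rule sum.cong[OF refl sum.swap])
  also have "\<dots> = (\<Sum>S\<in>k_subsets n k. sesq (embed_local n S (h S)) B u v)"
    unfolding sesq_def by (rule sum.swap)
  finally show ?thesis .
qed

lemma hamiltonian_hermitian:
  assumes "valid_instance n d k h"
  shows "is_hermitian (hamiltonian n k h) (basis_states {0..<n} d)"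
proof -
  have "embed_local n S (h S) x y = cnj (embed_local n S (h S) y x)"
    if "S \<in> k_subsets n k" "x \<in> basis_states {0..<n} d" "y \<in> basis_states {0..<n} d" for S x y
  proof -
    have S: "S \<subseteq> {0..<n}" using that by (simp add: k_subsets_def)
    have "is_hermitian (h S) (basis_states S d)"
      using assms that(1) by (simp add: valid_instance_def is_psd_def)
    moreover have "restrict x S \<in> basis_states S d" "restrict y S \<in> basis_states S d"
      using that S by (auto simp: basis_states_def PiE_def Pi_def)
    ultimately have "h S (restrict x S) (restrict y S) = cnj (h S (restrict y S) (restrict x S))"
      unfolding is_hermitian_def by blast
    then show ?thesis by (auto simp: embed_local_def)
  qed
  then show ?thesis
    unfolding is_hermitian_def hamiltonian_def cnj_sum by (intro ballI sum.cong refl)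
qed

text \<open>With \<open>d \<ge> 1\<close> there is a basis state, so the set of eigenvalues is
  finite and nonempty and its \<open>Max\<close> belongs to a genuine eigenvector. Because
  \<open>ip B v v\<close> is real, taking the real part of \<open>c * ip B v v\<close> yields
  \<open>Re c\<close>, as in \<open>OPT\<close>.\<close>

lemma OPT_attained:
  assumes "d \<ge> 1" "valid_instance n d k h"
  obtains v where "Re (ip (basis_states {0..<n} d) v v) > 0"
    "Re (sesq (hamiltonian n k h) (basis_states {0..<n} d) v v) =
       OPT n d k h * Re (ip (basis_states {0..<n} d) v v)"
proof -
  define B where "B = basis_states {0..<n} d"
  define H where "H = hamiltonian n k h"
  have fin: "finite B" by (simp add: B_def finite_basis_states)
  have "B \<noteq> {}" using assms(1) by (simp add: B_def basis_states_def PiE_eq_empty_iff)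
  with fin hamiltonian_hermitian[OF assms(2)]
  have "finite (Re ` {c. is_eigenvalue H B c})" "Re ` {c. is_eigenvalue H B c} \<noteq> {}"
    using eigenvalues_finite_nonempty[of B H] unfolding B_def H_def by auto
  then have "OPT n d k h \<in> Re ` {c. is_eigenvalue H B c}"
    unfolding OPT_def B_def H_def by (rule Max_in)
  then obtain c where c: "is_eigenvalue H B c" "OPT n d k h = Re c" by auto
  then obtain v a where v: "a \<in> B" "v a \<noteq> 0" "\<And>a. a \<in> B \<Longrightarrow> mat_app H B v a = c * v a"
    unfolding is_eigenvalue_def mat_app_def by blast
  have "Re (ip B v v) \<noteq> 0" using ip_self_eq_0[OF fin] v by blast
  then have "Re (ip B v v) > 0" using Re_ip_self_ge_0[of B v] by simp
  moreover have "sesq H B v v = c * ip B v v"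
    unfolding sesq_eq_ip using v(3) by (simp add: ip_simps(3)[symmetric] cong: ip_cong)
  then have "Re (sesq H B v v) = OPT n d k h * Re (ip B v v)"
    by (simp add: c(2) ip_self)
  ultimately show ?thesis using that unfolding B_def H_def by blast
qed

theorem theorem1:
  fixes n d k :: nat
    and h :: "nat set \<Rightarrow> (nat \<Rightarrow> nat) \<Rightarrow> (nat \<Rightarrow> nat) \<Rightarrow> complex"
  assumes "k \<ge> 1" and "d \<ge> 1" and "n \<ge> k"
    and "valid_instance n d k h"
  shows "\<exists>\<phi>. (\<forall>i<n. unit_vec d (\<phi> i)) \<and>
           Re (qform (hamiltonian n k h) (basis_states {0..<n} d) (product_state n \<phi>))
             \<ge> OPT n d k h / real d ^ (k - 1)"
proof -
  define B where "B = basis_states {0..<n} d"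
  define F where "F = k_subsets n k"
  define c where "c = OPT n d k h / real d ^ (k - 1)"
  have F: "S \<subseteq> {0..<n} \<and> is_psd (h S) (basis_states S d)" if "S \<in> F" for S
    using that assms(4) by (simp add: F_def k_subsets_def valid_instance_def)
  have "\<exists>\<phi> \<psi>. (\<forall>i<m. unit_vec d (\<phi> i)) \<and> achieves n d F h c m (partial_product n m \<phi> \<psi>)"
    if "m \<le> n" for m
    using that
  proof (induction m)
    case 0
    obtain v where v: "Re (ip B v v) > 0"
      "Re (sesq (hamiltonian n k h) B v v) = OPT n d k h * Re (ip B v v)"
      by (rule OPT_attained[OF assms(2,4), folded B_def]) (rule that)
    \<comment> \<open>At \<open>m = 0\<close> no factor is fixed, so the zero function is only a
      placeholder. The vectors \<open>u\<close> and \<open>v\<close> need agree only on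
      \<open>B\<close>, where restriction to all qudits changes nothing.\<close>
    define u where "u = partial_product n 0 (\<lambda>_ _. 0) v"
    have u: "u x = v x" if "x \<in> B" for x
      using that by (simp add: u_def partial_product_def B_def basis_states_def PiE_restrict)
    have ip_u: "ip B u u = ip B v v" using u by (intro ip_cong) auto
    have sesq_u: "sesq A B u u = sesq A B v v" for A using u by (intro sesq_cong) auto
    have "weighted_value n d F h 0 u = (\<Sum>S\<in>F. Re (sesq (embed_local n S (h S)) B v v) / real d ^ (k - 1))"
      unfolding weighted_value_def B_def[symmetric] sesq_u
    proof (rule sum.cong[OF refl])
      \<comment> \<open>All \<open>k\<close> qudits of \<open>S\<close> are still unprocessed, so
        every term starts with the same weight; this is where the exponent \<open>k - 1\<close>
        comes from.\<close>
      fix S assume "S \<in> F"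
      then have "S \<inter> {0..<n} = S" "card S = k" by (auto simp: F_def k_subsets_def)
      then show "site_weight n d 0 S * Re (sesq (embed_local n S (h S)) B v v) =
          Re (sesq (embed_local n S (h S)) B v v) / real d ^ (k - 1)"
        by (simp add: site_weight_def)
    qed
    also have "\<dots> = c * Re (ip B v v)"
      using v(2) by (simp add: sesq_hamiltonian F_def c_def flip: sum_divide_distrib)
    finally have "achieves n d F h c 0 u"
      using v(1) by (simp add: achieves_def ip_u flip: B_def)
    then show ?case unfolding u_def by blast
  next
    case (Suc m)
    then obtain \<phi> \<psi> where \<phi>: "\<forall>i<m. unit_vec d (\<phi> i)"
      and ach: "achieves n d F h c m (partial_product n m \<phi> \<psi>)"
      by auto
    have "m < n" using Suc.prems by simp
    from partial_product_step[OF assms(2) this F ach]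
    obtain u \<eta> where u: "unit_vec d u"
      and ach': "achieves n d F h c (Suc m) (partial_product n (Suc m) (\<phi>(m := u)) \<eta>)"
      by blast
    from u \<phi> have "\<forall>i<Suc m. unit_vec d ((\<phi>(m := u)) i)" by (simp add: less_Suc_eq)
    with ach' show ?case by blast
  qed
  from this[of n] obtain \<phi> \<psi> where unit: "\<forall>i<n. unit_vec d (\<phi> i)"
    and ach: "achieves n d F h c n (partial_product n n \<phi> \<psi>)"
    by auto
  define p where "p = product_state n \<phi>"
  \<comment> \<open>At \<open>m = n\<close> the remaining vector is evaluated only at the
    restriction to the empty set, the constantly \<open>undefined\<close> function, and has become a
    scalar. \<open>achieves\<close> makes it nonzero, so it cancels at the end.\<close>
  define z where "z = \<psi> (\<lambda>_. undefined)"
  have pp: "partial_product n n \<phi> \<psi> = (\<lambda>x. z * p x)"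
    by (simp add: fun_eq_iff partial_product_def p_def product_state_def z_def restrict_def)
  have N: "Re (ip B (\<lambda>x. z * p x) (\<lambda>x. z * p x)) = (cmod z)\<^sup>2"
    using norm_product_state[of n d \<phi>] unit
    by (simp add: Re_ip_self norm_mult power_mult_distrib flip: sum_distrib_left) (simp add: p_def B_def Re_ip_self)
  have scale: "sesq A B (\<lambda>x. z * p x) (\<lambda>x. z * p x) = complex_of_real ((cmod z)\<^sup>2) * sesq A B p p" for A
    unfolding complex_norm_square sesq_def sum_distrib_left by (intro sum.cong refl) (simp add: mult_ac)
  have "weighted_value n d F h n (\<lambda>x. z * p x) = (cmod z)\<^sup>2 * Re (qform (hamiltonian n k h) B p)"
    unfolding weighted_value_def B_def[symmetric] qform_eq_sesq sesq_hamiltonian scale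
    by (simp add: site_weight_def F_def sum_distrib_left)
  then have "(cmod z)\<^sup>2 > 0" "(cmod z)\<^sup>2 * c \<le> (cmod z)\<^sup>2 * Re (qform (hamiltonian n k h) B p)"
    using ach unfolding achieves_def pp B_def[symmetric] N by (simp_all add: mult.commute)
  then have "c \<le> Re (qform (hamiltonian n k h) B p)" by simp
  then show ?thesis using unit unfolding c_def B_def p_def by blast
qed

end
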